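(* Let $m\ge 1$, let $\omega=(w_1,\ldots,w_m)$ be a probability vector, let $c>0$, and let $A_1,\ldots,A_m\in\mathrm{UT}_2$. Denote $D=\operatorname{diag}(d_1,d_2)=\operatorname{diag}(A_1^{w_1}\cdots A_m^{w_m})$, $D^{-1}A_i=\begin{bmatrix} a_{11}^{(i)} & a_{12}^{(i)}\\ 0 & a_{22}^{(i)}\end{bmatrix}$ for $i=1,\ldots,m$, and $$c_0=\sum_{i=1}^m w_i\, f\left(\frac{a_{22}^{(i)}}{a_{11}^{(i)}},\,1\right)=\sum_{i=1}^m w_i\,\frac{a_{22}^{(i)}}{a_{22}^{(i)}-a_{11}^{(i)}}\log\left(\frac{a_{22}^{(i)}}{a_{11}^{(i)}}\right),$$ where a summand of the last sum with $a_{11}^{(i)}=a_{22}^{(i)}$ is read as $w_i$ (by continuity). Suppose $X_0\in\mathrm{UT}_2$ satisfies $\operatorname{diag}(X_0)=D$, and let $\{X_k\}$ be generated by the projection mean iteration $$\log(X_k^{-1}X_{k+1})=\frac1c\sum_{i=1}^m w_i\log(X_k^{-1}A_i),\qquad k\ge 0.$$ Then $\operatorname{diag}(X_k)=D$ for all $k=0,1,2,\ldots$, and the $(1,2)$-entries of $X_k^{-1}X_{k+1}$ (respectively, of $\log(X_k^{-1}X_{k+1})$), $k\ge0$, form a geometric sequence with ratio $1-\dfrac{c_0}{c}$.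
   Context: $\mathrm{UT}_2$ is the group of $2\times 2$ real upper triangular matrices with positive diagonal entries. A probability vector has nonnegative entries summing to $1$. For $A\in\mathrm{UT}_2$, $\log A$ is the principal logarithm (the unique real upper triangular matrix $L$ with $\exp L=A$), and $A^{p}=\exp(p\log A)$ for $p\in\mathbb{R}$. $\operatorname{diag}(A)$ is the diagonal matrix formed from the diagonal entries of $A$, and $\operatorname{diag}(d_1,d_2)$ is the diagonal matrix with the given entries. For $x,y>0$, $f(x,y)=\dfrac{\log x-\log y}{x-y}$ if $x\neq y$, and $f(x,x)=1/x$. The iteration is equivalently $X_{k+1}=X_k\exp\left(\frac1c\sum_i w_i\log(X_k^{-1}A_i)\right)$. A sequence $(z_k)_{k\ge 0}$ is geometric with ratio $r$ if $z_{k+1}=r z_k$ for all $k\ge0$. *)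

theory Defs
  imports "HOL-Analysis.Analysis"
begin

definition prob_vector :: "nat \<Rightarrow> (nat \<Rightarrow> real) \<Rightarrow> bool" where
  "prob_vector m w \<longleftrightarrow> (\<forall>i\<in>{1..m}. 0 \<le> w i) \<and> (\<Sum>i=1..m. w i) = 1"

definition upper_triangular2 :: "real^2^2 \<Rightarrow> bool" where
  "upper_triangular2 A \<longleftrightarrow> A$2$1 = 0"

definition UT2 :: "(real^2^2) set" where
  "UT2 = {A. upper_triangular2 A \<and> 0 < A$1$1 \<and> 0 < A$2$2}"

definition diag_part :: "real^'n^'n \<Rightarrow> real^'n^'n" where
  "diag_part A = (\<chi> i j. if i = j then A$i$j else 0)"

(* The class operations * and ^ on the type real^'n^'n are entrywise, so the library's exp
   is not available; powers are taken with respect to the matrix product **. *)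
definition mat_power :: "real^'n^'n \<Rightarrow> nat \<Rightarrow> real^'n^'n" where
  "mat_power A n = (((**) A) ^^ n) (mat 1)"

definition mat_exp :: "real^'n^'n \<Rightarrow> real^'n^'n" where
  "mat_exp A = (\<Sum>n. (1 / fact n) *\<^sub>R mat_power A n)"

(* Only meaningful for A in UT2, where such an L exists and is unique. *)
definition mat_log :: "real^2^2 \<Rightarrow> real^2^2" where
  "mat_log A = (THE L. upper_triangular2 L \<and> mat_exp L = A)"

definition mat_powr :: "real^2^2 \<Rightarrow> real \<Rightarrow> real^2^2" where
  "mat_powr A p = mat_exp (p *\<^sub>R mat_log A)"

definition mat_prod_list :: "(real^'n^'n) list \<Rightarrow> real^'n^'n" where
  "mat_prod_list Ms = foldr (**) Ms (mat 1)"

definition log_quotient :: "real \<Rightarrow> real \<Rightarrow> real" where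
  "log_quotient x y = (if x = y then 1 / x else (ln x - ln y) / (x - y))"

(* Membership X (Suc k) \<in> UT2 is part of the iteration: mat_log is the logarithm on UT2 only. *)
definition projection_mean_iteration ::
  "nat \<Rightarrow> (nat \<Rightarrow> real) \<Rightarrow> real \<Rightarrow> (nat \<Rightarrow> real^2^2) \<Rightarrow> (nat \<Rightarrow> real^2^2) \<Rightarrow> bool" where
  "projection_mean_iteration m w c A X \<longleftrightarrow>
     (\<forall>k. X (Suc k) \<in> UT2 \<and>
          mat_log (matrix_inv (X k) ** X (Suc k)) =
            (1 / c) *\<^sub>R (\<Sum>i=1..m. w i *\<^sub>R mat_log (matrix_inv (X k) ** A i)))"

definition geometric_with_ratio :: "real \<Rightarrow> (nat \<Rightarrow> real) \<Rightarrow> bool" where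
  "geometric_with_ratio r z \<longleftrightarrow> (\<forall>k. z (Suc k) = r * z k)"

end

theory Submission
  imports Defs
begin

text \<open>
  The diagonal part is multiplicative on upper triangular matrices, so the iteration decouples.
  On the diagonal the weighted logarithms of \<open>D\<inverse> A\<^sub>i\<close> sum to zero, hence \<open>X\<^sub>k\<close> keeps the
  diagonal \<open>D\<close> and each step \<open>X\<^sub>k\<inverse> X\<^sub>k\<^sub>+\<^sub>1\<close> is unipotent. In the (1,2)-entry \<open>x\<^sub>k\<close> of
  \<open>X\<^sub>k\<close> the right-hand side of the iteration is affine with slope proportional to
  \<open>\<Sum> w\<^sub>i a\<^sub>2\<^sub>2 f(a\<^sub>1\<^sub>1, a\<^sub>2\<^sub>2)\<close>, which gives the geometric ratio.

  The two formulas for \<open>c\<^sub>0\<close> do not agree summand by summand: since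
  \<open>f(a\<^sub>2\<^sub>2/a\<^sub>1\<^sub>1, 1) = a\<^sub>1\<^sub>1 f(a\<^sub>1\<^sub>1, a\<^sub>2\<^sub>2)\<close>, they differ by
  \<open>\<Sum> w\<^sub>i ln (a\<^sub>2\<^sub>2/a\<^sub>1\<^sub>1)\<close>, which vanishes by the same diagonal identity.
\<close>

section \<open>Coordinates for upper triangular matrices\<close>

definition tri :: "real \<Rightarrow> real \<Rightarrow> real \<Rightarrow> real^2^2" where
  "tri a b d = vector [vector [a, b], vector [0, d]]"

lemma tri_nth [simp]:
  "tri a b d $ 1 $ 1 = a" "tri a b d $ 1 $ 2 = b" "tri a b d $ 2 $ 1 = 0" "tri a b d $ 2 $ 2 = d"
  by (simp_all add: tri_def)

lemma upper_triangular2_tri [simp]: "upper_triangular2 (tri a b d)"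
  by (simp add: upper_triangular2_def)

lemma tri_eq_iff [simp]: "tri a b d = tri a' b' d' \<longleftrightarrow> a = a' \<and> b = b' \<and> d = d'"
  by (auto simp: vec_eq_iff forall_2)

lemma upper_triangular2_tri_eq: "upper_triangular2 L \<Longrightarrow> L = tri (L$1$1) (L$1$2) (L$2$2)"
  by (auto simp: upper_triangular2_def vec_eq_iff forall_2)

lemma UT2_tri_eq: "M \<in> UT2 \<Longrightarrow> M = tri (M$1$1) (M$1$2) (M$2$2)"
  by (simp add: UT2_def upper_triangular2_tri_eq)

lemma mat_1_tri: "mat 1 = tri 1 0 1"
  by (simp add: vec_eq_iff forall_2 mat_def)

lemma tri_mult [simp]: "tri a b d ** tri a' b' d' = tri (a * a') (a * b' + b * d') (d * d')"
  by (simp add: vec_eq_iff forall_2 matrix_matrix_mult_def sum_2)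

lemma scaleR_tri [simp]: "r *\<^sub>R tri a b d = tri (r * a) (r * b) (r * d)"
  by (simp add: vec_eq_iff forall_2)

lemma sum_tri: "(\<Sum>i\<in>I. tri (a i) (b i) (d i)) = tri (\<Sum>i\<in>I. a i) (\<Sum>i\<in>I. b i) (\<Sum>i\<in>I. d i)"
  by (simp add: vec_eq_iff forall_2)

lemma diag_part_tri [simp]: "diag_part (tri a b d) = tri a 0 d"
  by (simp add: vec_eq_iff forall_2 diag_part_def)

lemma matrix_inv_tri [simp]:
  assumes "a \<noteq> 0" "d \<noteq> 0"
  shows "matrix_inv (tri a b d) = tri (1 / a) (- b / (a * d)) (1 / d)"
proof -
  let ?M = "tri a b d" and ?N = "tri (1 / a) (- b / (a * d)) (1 / d)"
  have MN: "?M ** ?N = mat 1" and NM: "?N ** ?M = mat 1"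
    using assms by (simp_all add: mat_1_tri field_simps)
  \<comment> \<open>\<open>matrix_inv\<close> is a choice, so the witness \<open>?N\<close> only
    shows that the chosen matrix is some inverse; associativity then identifies it with
    \<open>?N\<close>.\<close>
  have "matrix_inv ?M ** ?M = mat 1"
    unfolding matrix_inv_def by (rule someI2[where a = ?N]) (simp_all only: MN NM)
  then have "matrix_inv ?M ** (?M ** ?N) = ?N"
    by (simp only: matrix_mul_assoc matrix_mul_lid)
  then show ?thesis by (simp only: MN matrix_mul_rid)
qed

lemma tendsto_tri [tendsto_intros]:
  assumes "(a \<longlongrightarrow> a') F" "(b \<longlongrightarrow> b') F" "(d \<longlongrightarrow> d') F"
  shows "((\<lambda>n. tri (a n) (b n) (d n)) \<longlongrightarrow> tri a' b' d') F"
proof (intro vec_tendstoI)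
  fix i j :: 2
  show "((\<lambda>n. tri (a n) (b n) (d n) $ i $ j) \<longlongrightarrow> tri a' b' d' $ i $ j) F"
    using exhaust_2[of i] exhaust_2[of j] assms by auto
qed

lemma sums_tri:
  assumes "a sums a'" "b sums b'" "d sums d'"
  shows "(\<lambda>n. tri (a n) (b n) (d n)) sums tri a' b' d'"
  using assms unfolding sums_def sum_tri by (intro tendsto_tri)

section \<open>Matrix exponential and logarithm in closed form\<close>

definition power_quotient :: "real \<Rightarrow> real \<Rightarrow> nat \<Rightarrow> real" where
  "power_quotient a d n = (if a = d then real n * a ^ (n - 1) else (a ^ n - d ^ n) / (a - d))"

text \<open>\<open>power_quotient\<close> and \<open>exp_quotient\<close> are the divided
  differences at \<open>a\<close>, \<open>d\<close> of the n-th power and of exp, continued by the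
  derivative to \<open>a = d\<close>. They are the factors that multiply \<open>b\<close> in the
  powers and in the exponential of \<open>tri a b d\<close>.\<close>

definition exp_quotient :: "real \<Rightarrow> real \<Rightarrow> real" where
  "exp_quotient a d = (if a = d then exp a else (exp a - exp d) / (a - d))"

text \<open>This is the recursion of the (1,2)-entry under left multiplication by
  \<open>tri a 1 d\<close>.\<close>

lemma power_quotient_Suc: "power_quotient a d (Suc n) = a * power_quotient a d n + d ^ n"
proof (cases "a = d")
  case True
  then show ?thesis by (cases n) (auto simp: power_quotient_def algebra_simps)
next
  case False
  then show ?thesis by (simp add: power_quotient_def field_simps)
qed

lemma power_quotient_sums: "(\<lambda>n. 1 / fact n * power_quotient a d n) sums exp_quotient a d"
proof (cases "a = d")
  case True
  \<comment> \<open>At \<open>a = d\<close> the factor n cancels against the factorial; dropping the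
    zeroth term, which is 0, leaves the exponential series.\<close>
  have "(\<lambda>n. 1 / fact (Suc n) * power_quotient a d (Suc n)) = (\<lambda>n. a ^ n /\<^sub>R fact n)"
    using True by (auto simp: power_quotient_def field_simps simp del: of_nat_Suc)
  then have "(\<lambda>n. 1 / fact (Suc n) * power_quotient a d (Suc n)) sums exp_quotient a d"
    using exp_converges[of a] True by (simp add: exp_quotient_def)
  then show ?thesis
    by (subst (asm) sums_Suc_iff) (simp add: power_quotient_def True)
next
  case False
  have "(\<lambda>n. (a ^ n /\<^sub>R fact n - d ^ n /\<^sub>R fact n) / (a - d)) sums ((exp a - exp d) / (a - d))"
    by (intro sums_divide sums_diff exp_converges)
  moreover have "(\<lambda>n. 1 / fact n * power_quotient a d n)
      = (\<lambda>n. (a ^ n /\<^sub>R fact n - d ^ n /\<^sub>R fact n) / (a - d))"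
    using False by (auto simp: power_quotient_def field_simps)
  ultimately show ?thesis using False by (simp add: exp_quotient_def)
qed

lemma mat_power_tri: "mat_power (tri a b d) n = tri (a ^ n) (b * power_quotient a d n) (d ^ n)"
proof (induction n)
  case 0
  then show ?case by (simp add: mat_power_def mat_1_tri power_quotient_def)
next
  case (Suc n)
  have "mat_power (tri a b d) (Suc n) = tri a b d ** mat_power (tri a b d) n"
    by (simp add: mat_power_def)
  then show ?case by (simp add: Suc power_quotient_Suc algebra_simps)
qed

lemma mat_exp_tri: "mat_exp (tri a b d) = tri (exp a) (b * exp_quotient a d) (exp d)"
proof -
  have exp: "(\<lambda>n. 1 / fact n * x ^ n) sums exp x" for x :: real
    using exp_converges[of x] by (simp add: field_simps)
  have "(\<lambda>n. tri (1 / fact n * a ^ n) (b * (1 / fact n * power_quotient a d n)) (1 / fact n * d ^ n))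
      sums tri (exp a) (b * exp_quotient a d) (exp d)"
    by (intro sums_tri exp sums_mult power_quotient_sums)
  then have "(\<lambda>n. (1 / fact n) *\<^sub>R mat_power (tri a b d) n)
      sums tri (exp a) (b * exp_quotient a d) (exp d)"
    by (simp add: mat_power_tri mult.left_commute)
  then show ?thesis unfolding mat_exp_def by (rule sums_unique[symmetric])
qed

text \<open>Divided differences of inverse functions at corresponding points are reciprocal. In
  particular \<open>exp_quotient (ln x) (ln z)\<close> is nonzero.\<close>

lemma exp_quotient_ln_log_quotient:
  assumes "0 < x" "0 < z"
  shows "log_quotient x z * exp_quotient (ln x) (ln z) = 1"
  using assms by (auto simp: log_quotient_def exp_quotient_def)

text \<open>Uniqueness: injectivity of exp fixes the diagonal of \<open>L\<close>, and then the
  (1,2)-entry of \<open>mat_exp L\<close> is that of \<open>L\<close> times a known nonzero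
  factor.\<close>

lemma mat_log_tri:
  assumes "0 < x" "0 < z"
  shows "mat_log (tri x y z) = tri (ln x) (y * log_quotient x z) (ln z)"
  unfolding mat_log_def
proof (rule the_equality)
  have inv: "log_quotient x z * exp_quotient (ln x) (ln z) = 1"
    by (rule exp_quotient_ln_log_quotient[OF assms])
  then show "upper_triangular2 (tri (ln x) (y * log_quotient x z) (ln z)) \<and>
      mat_exp (tri (ln x) (y * log_quotient x z) (ln z)) = tri x y z"
    using assms by (simp add: mat_exp_tri mult.assoc)
  fix L assume L: "upper_triangular2 L \<and> mat_exp L = tri x y z"
  obtain a b d where Leq: "L = tri a b d" using L upper_triangular2_tri_eq by blast
  with L have eq: "exp a = x" "b * exp_quotient a d = y" "exp d = z" by (auto simp: mat_exp_tri)
  then have ad: "a = ln x" "d = ln z" by auto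
  have "y * log_quotient x z = b * (log_quotient x z * exp_quotient (ln x) (ln z))"
    using eq(2) ad by auto
  then have "b = y * log_quotient x z" by (simp add: inv)
  with Leq ad show "L = tri (ln x) (y * log_quotient x z) (ln z)" by simp
qed

section \<open>Diagonal of the weighted product of powers\<close>

lemma mat_powr_tri:
  assumes "0 < x" "0 < z"
  shows "\<exists>b. mat_powr (tri x y z) p = tri (exp (p * ln x)) b (exp (p * ln z))"
  by (simp add: mat_powr_def mat_log_tri[OF assms] mat_exp_tri)

text \<open>Diagonals multiply independently of the (1,2)-entries, so the latter can stay
  existential: \<open>diag_part\<close> discards them.\<close>

lemma mat_prod_list_tri_diag:
  assumes "\<forall>i\<in>set js. \<exists>b. M i = tri (exp (p i)) b (exp (q i))"
  shows "\<exists>b. mat_prod_list (map M js) = tri (exp (\<Sum>i\<leftarrow>js. p i)) b (exp (\<Sum>i\<leftarrow>js. q i))"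
  using assms
proof (induction js)
  case Nil
  then show ?case by (auto simp: mat_prod_list_def mat_1_tri)
next
  case (Cons j js)
  then obtain b b' where "M j = tri (exp (p j)) b (exp (q j))"
    "mat_prod_list (map M js) = tri (exp (\<Sum>i\<leftarrow>js. p i)) b' (exp (\<Sum>i\<leftarrow>js. q i))" by auto
  then show ?case by (auto simp: mat_prod_list_def exp_add)
qed

lemma diag_part_weighted_powr_prod:
  assumes "\<And>i. i \<in> {1..m} \<Longrightarrow> A i \<in> UT2"
  shows "diag_part (mat_prod_list (map (\<lambda>i. mat_powr (A i) (w i)) [1..<Suc m]))
    = tri (exp (\<Sum>i=1..m. w i * ln (A i$1$1))) 0 (exp (\<Sum>i=1..m. w i * ln (A i$2$2)))"
proof -
  have "\<exists>b. mat_powr (A i) (w i) = tri (exp (w i * ln (A i$1$1))) b (exp (w i * ln (A i$2$2)))"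
    if "i \<in> {1..m}" for i
    using mat_powr_tri[of "A i$1$1" "A i$2$2" "A i$1$2" "w i"] assms[OF that] UT2_tri_eq[of "A i"]
    by (simp add: UT2_def)
  then have "\<forall>i\<in>set [1..<Suc m].
      \<exists>b. mat_powr (A i) (w i) = tri (exp (w i * ln (A i$1$1))) b (exp (w i * ln (A i$2$2)))"
    by auto
  from mat_prod_list_tri_diag[OF this] show ?thesis
    by (auto simp: interv_sum_list_conv_sum_set_nat atLeastLessThanSuc_atLeastAtMost
        simp del: upt_Suc)
qed

text \<open>The first identity is homogeneity of degree -1. The third rests on (b - a) f(a, b) = ln
  b - ln a, which holds also at \<open>a = b\<close>, where both sides are 0.\<close>

lemma log_quotient_ratio:
  assumes "0 < a" "0 < b"
  shows "log_quotient (b / a) 1 = a * log_quotient a b"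
    and "b * log_quotient a b = (if a = b then 1 else b / (b - a) * ln (b / a))"
    and "b * log_quotient a b = log_quotient (b / a) 1 + (ln b - ln a)"
proof -
  have *: "(ln b - ln a) / (b / a - 1) = a * ((ln a - ln b) / (a - b))" if "a \<noteq> b"
    using assms that by (simp add: field_simps)
  show 1: "log_quotient (b / a) 1 = a * log_quotient a b"
    using assms * by (auto simp: log_quotient_def ln_div)
  show "b * log_quotient a b = (if a = b then 1 else b / (b - a) * ln (b / a))"
    using assms by (auto simp: log_quotient_def ln_div field_simps)
  have "(b - a) * log_quotient a b = ln b - ln a"
    using assms by (auto simp: log_quotient_def field_simps)
  then show "b * log_quotient a b = log_quotient (b / a) 1 + (ln b - ln a)"
    using assms unfolding 1 by (simp add: algebra_simps)
qed

section \<open>Reduction of the iteration to a scalar recurrence\<close>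

theorem theorem2p3:
  fixes m :: nat and w :: "nat \<Rightarrow> real" and c c0 :: real
    and A B X :: "nat \<Rightarrow> real^2^2" and D :: "real^2^2"
  assumes "m \<ge> 1"
    and "prob_vector m w"
    and "c > 0"
    and "\<forall>i\<in>{1..m}. A i \<in> UT2"
    and "D = diag_part (mat_prod_list (map (\<lambda>i. mat_powr (A i) (w i)) [1..<Suc m]))"
    and "\<forall>i\<in>{1..m}. B i = matrix_inv D ** A i"
    and "c0 = (\<Sum>i=1..m. w i * log_quotient (B i$2$2 / B i$1$1) 1)"
    and "X 0 \<in> UT2"
    and "diag_part (X 0) = D"
    and "projection_mean_iteration m w c A X"
  shows "c0 = (\<Sum>i=1..m. w i * (if B i$1$1 = B i$2$2 then 1
                 else B i$2$2 / (B i$2$2 - B i$1$1) * ln (B i$2$2 / B i$1$1)))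
    \<and> (\<forall>k. diag_part (X k) = D)
    \<and> geometric_with_ratio (1 - c0 / c) (\<lambda>k. (matrix_inv (X k) ** X (Suc k))$1$2)
    \<and> geometric_with_ratio (1 - c0 / c) (\<lambda>k. mat_log (matrix_inv (X k) ** X (Suc k))$1$2)"
proof -
  define d1 d2 where "d1 = exp (\<Sum>i=1..m. w i * ln (A i$1$1))"
    and "d2 = exp (\<Sum>i=1..m. w i * ln (A i$2$2))"
  \<comment> \<open>\<open>p i\<close> and \<open>q i\<close> will be the diagonal entries of
    \<open>B i\<close>, and \<open>y k\<close> the (1,2)-entry of the k-th step once both iterates
    are known to have diagonal \<open>D\<close>.\<close>
  define p q where "p i = A i$1$1 / d1" and "q i = A i$2$2 / d2" for i
  define x where "x k = X k$1$2" for k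
  define y where "y k = (x (Suc k) - x k) / d1" for k
  have d: "0 < d1" "0 < d2" by (simp_all add: d1_def d2_def)
  have Apos: "0 < A i$1$1" "0 < A i$2$2" if "i \<in> {1..m}" for i
    using that assms(4) by (auto simp: UT2_def)
  have Aeq: "A i = tri (A i$1$1) (A i$1$2) (A i$2$2)" if "i \<in> {1..m}" for i
    using that assms(4) UT2_tri_eq by blast
  have pq: "0 < p i" "0 < q i" if "i \<in> {1..m}" for i
    using Apos[OF that] d by (simp_all add: p_def q_def)
  have D: "D = tri d1 0 d2"
    using diag_part_weighted_powr_prod assms(4,5) by (simp add: d1_def d2_def)
  have step: "matrix_inv (tri d1 z d2) ** A i = tri (p i) ((A i$1$2 - z * q i) / d1) (q i)"
    if "i \<in> {1..m}" for i z
    using d by (subst Aeq[OF that]) (simp add: p_def q_def field_simps)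
  have B: "B i$1$1 = p i" "B i$2$2 = q i" if "i \<in> {1..m}" for i
    using assms(6) that step[OF that, of 0] D by simp_all
  have ln_p: "ln (p i) = ln (A i$1$1) - ln d1" and ln_q: "ln (q i) = ln (A i$2$2) - ln d2"
    if "i \<in> {1..m}" for i
    using Apos[OF that] d by (simp_all add: p_def q_def ln_divide_pos)
  have sw: "(\<Sum>i=1..m. w i) = 1" using assms(2) by (simp add: prob_vector_def)
  \<comment> \<open>The weights sum to 1 and \<open>ln d1\<close> is the weighted mean of the
    logarithms, so centring by it gives 0; likewise for \<open>d2\<close>.\<close>
  have "(\<Sum>i=1..m. w i * ln (p i)) = (\<Sum>i=1..m. w i * ln (A i$1$1)) - (\<Sum>i=1..m. w i) * ln d1"
    unfolding sum_distrib_right sum_subtractf[symmetric]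
    by (intro sum.cong refl) (simp only: ln_p right_diff_distrib)
  then have lp: "(\<Sum>i=1..m. w i * ln (p i)) = 0" unfolding sw by (simp add: d1_def)
  have "(\<Sum>i=1..m. w i * ln (q i)) = (\<Sum>i=1..m. w i * ln (A i$2$2)) - (\<Sum>i=1..m. w i) * ln d2"
    unfolding sum_distrib_right sum_subtractf[symmetric]
    by (intro sum.cong refl) (simp only: ln_q right_diff_distrib)
  then have lq: "(\<Sum>i=1..m. w i * ln (q i)) = 0" unfolding sw by (simp add: d2_def)

  have "(\<Sum>i=1..m. w i * (q i * log_quotient (p i) (q i)))
      = (\<Sum>i=1..m. w i * log_quotient (q i / p i) 1 + (w i * ln (q i) - w i * ln (p i)))"
    by (intro sum.cong refl)
      (simp only: log_quotient_ratio(3)[OF pq] distrib_left right_diff_distrib)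
  also have "\<dots> = (\<Sum>i=1..m. w i * log_quotient (q i / p i) 1)"
    by (simp only: sum.distrib sum_subtractf lp lq diff_0_right add_0_right)
  also have "\<dots> = c0" unfolding assms(7) by (intro sum.cong) (simp_all add: B)
  finally have c0: "c0 = (\<Sum>i=1..m. w i * (q i * log_quotient (p i) (q i)))" by simp
  have c0': "c0 = (\<Sum>i=1..m. w i * (if B i$1$1 = B i$2$2 then 1
                 else B i$2$2 / (B i$2$2 - B i$1$1) * ln (B i$2$2 / B i$1$1)))"
    unfolding c0 by (intro sum.cong refl) (simp only: B pq log_quotient_ratio(2))

  \<comment> \<open>Stated for arbitrary \<open>z\<close>, so that it serves both the induction for
    the diagonal, through the induction hypothesis, and the recurrence for \<open>y\<close>.\<close>
  have mean: "(1 / c) *\<^sub>R (\<Sum>i=1..m. w i *\<^sub>R mat_log (matrix_inv (tri d1 z d2) ** A i))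
      = tri 0 (1 / c * (\<Sum>i=1..m. w i * ((A i$1$2 - z * q i) / d1 * log_quotient (p i) (q i)))) 0"
    for z
  proof -
    have "(\<Sum>i=1..m. w i *\<^sub>R mat_log (matrix_inv (tri d1 z d2) ** A i))
      = (\<Sum>i=1..m. tri (w i * ln (p i))
          (w i * ((A i$1$2 - z * q i) / d1 * log_quotient (p i) (q i))) (w i * ln (q i)))"
      by (intro sum.cong refl) (simp add: step mat_log_tri pq)
    then show ?thesis by (simp only: sum_tri lp lq scaleR_tri mult_zero_right)
  qed
  have iter: "X (Suc k) \<in> UT2" "mat_log (matrix_inv (X k) ** X (Suc k)) =
            (1 / c) *\<^sub>R (\<Sum>i=1..m. w i *\<^sub>R mat_log (matrix_inv (X k) ** A i))" for k
    using assms(10) by (simp_all add: projection_mean_iteration_def)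
  have Xeq: "X k = tri d1 (x k) d2" for k
  proof (induction k)
    case 0
    have "X 0 = tri (X 0$1$1) (x 0) (X 0$2$2)"
      using UT2_tri_eq[OF assms(8)] by (simp add: x_def)
    moreover from this have "diag_part (X 0) = tri (X 0$1$1) 0 (X 0$2$2)"
      by (metis diag_part_tri)
    ultimately show ?case using assms(9) D by simp
  next
    case (Suc k)
    define u v where "u = X (Suc k)$1$1" and "v = X (Suc k)$2$2"
    have uv: "0 < u" "0 < v" using iter(1)[of k] by (simp_all add: UT2_def u_def v_def)
    have eq: "X (Suc k) = tri u (x (Suc k)) v"
      using UT2_tri_eq[OF iter(1)] by (simp add: x_def u_def v_def)
    \<comment> \<open>The diagonal of the next iterate is read off from the logarithm of the step:
      ln vanishes only at 1.\<close>
    have "mat_log (matrix_inv (X k) ** X (Suc k))$1$1 = 0"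
      "mat_log (matrix_inv (X k) ** X (Suc k))$2$2 = 0"
      by (simp_all only: iter(2)[of k, unfolded Suc mean] Suc tri_nth)
    then have "ln (u / d1) = 0" "ln (v / d2) = 0"
      using d uv by (simp_all add: Suc eq mat_log_tri)
    then have "u = d1" "v = d2" using d uv by (simp_all add: ln_div)
    with eq show ?case by simp
  qed
  have inc: "matrix_inv (X k) ** X (Suc k) = tri 1 (y k) 1" for k
    using d by (simp add: Xeq y_def field_simps)
  \<comment> \<open>Since \<open>log_quotient 1 1 = 1\<close>, a unipotent step and its logarithm
    share their (1,2)-entry; both sequences of the claim are therefore \<open>y\<close>.\<close>
  have log_inc: "mat_log (tri 1 (y k) 1) = tri 0 (y k) 0" for k
    by (simp add: mat_log_tri log_quotient_def)
  have y: "y k = 1 / c * (\<Sum>i=1..m. w i * ((A i$1$2 - x k * q i) / d1 * log_quotient (p i) (q i)))"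
    for k
    using iter(2)[of k, unfolded inc log_inc, unfolded Xeq mean] by (simp only: tri_eq_iff)
  have geo: "y (Suc k) = (1 - c0 / c) * y k" for k
  proof -
    let ?s = "\<lambda>z i. w i * ((A i$1$2 - z * q i) / d1 * log_quotient (p i) (q i))"
    \<comment> \<open>From one step to the next only \<open>z\<close> changes, by
      \<open>d1 * y k\<close>, and this \<open>d1\<close> cancels the denominator.\<close>
    have slope: "?s (x (Suc k)) i - ?s (x k) i = - y k * (w i * (q i * log_quotient (p i) (q i)))" for i
      using d by (simp add: y_def field_simps)
    have "y (Suc k) - y k = 1 / c * ((\<Sum>i=1..m. ?s (x (Suc k)) i) - (\<Sum>i=1..m. ?s (x k) i))"
      by (simp only: y[of "Suc k"] y[of k] right_diff_distrib)
    also have "\<dots> = 1 / c * (\<Sum>i=1..m. - y k * (w i * (q i * log_quotient (p i) (q i))))"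
      by (simp only: sum_subtractf[symmetric] slope)
    also have "\<dots> = - (c0 / c) * y k"
      unfolding c0 sum_distrib_left[symmetric] by simp
    finally show ?thesis by (simp add: algebra_simps)
  qed
  show ?thesis
    unfolding geometric_with_ratio_def inc log_inc tri_nth
    by (intro conjI allI c0' geo) (simp add: Xeq D)
qed

end
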